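(* Let $f(z)$ be a monic polynomial over an integral domain $\mathcal{O}$, and let $k$ and $m$ be positive integers such that $k\mid m$ and there exists a prime number $p\mid m$ with $p\nmid k$. Let $\alpha\in\overline{\mathrm{Frac}(\mathcal{O})}$ be a periodic point of $f$ of exact period $k$ and let $\lambda:=\omega_k(\alpha)=(f^{\circ k})'(\alpha)$ be its multiplier. Denote the $k$-part and the prime-to-$k$ part of $m$ by $$\widetilde m:=\prod_{p\mid k}p^{v_p(m)},\qquad m':=\prod_{p\nmid k}p^{v_p(m)}=\frac{m}{\widetilde m}>1,$$ respectively, where the products are over prime numbers $p$ and $v_p$ is the $p$-adic valuation. Then $$\prod_{d\mid\widetilde m}\Phi^*_{f,dm'}(\alpha)=\Phi^*_{f^{\circ\widetilde m},m'}(\alpha)=\Phi^{\mathrm{cyc}}_{m'}\!\left(\lambda^{\widetilde m/k}\right).$$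
   Context: $f^{\circ k}$ denotes the $k$-th iterate of $f$. For a polynomial $g$ over $\mathcal{O}$ and a positive integer $n$, the $n$-th dynatomic polynomial of $g$ is $\Phi^*_{g,n}(z)=\prod_{k\mid n}(g^{\circ k}(z)-z)^{\mu(n/k)}$, where $\mu$ is the Möbius function. $\Phi^{\mathrm{cyc}}_i(x)$ is the $i$-th cyclotomic polynomial. $\overline{\mathrm{Frac}(\mathcal{O})}$ is an algebraic closure of the fraction field of $\mathcal{O}$.
   Formalization: The polynomial f is assumed not to have degree 1: if f = z + c has a point of exact period k, then the k-th iterate of f is the identity, and the quotient defining the dynatomic polynomial of the iterate of order m̃ at m' is 0/0. *)

theory Defs
  imports
    Complex_Main
    "HOL-Computational_Algebra.Computational_Algebra"
    "HOL-Algebra.Algebraic_Closure_Type"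
begin

definition moebius_mu :: "nat \<Rightarrow> int" where
  "moebius_mu n = (if squarefree n then (-1) ^ card (prime_factors n) else 0)"

definition poly_iter :: "'a :: comm_semiring_1 poly \<Rightarrow> nat \<Rightarrow> 'a poly" where
  "poly_iter g j = (pcompose g ^^ j) [:0, 1:]"

text \<open>
  The product defining the dynatomic polynomial has negative exponents, so it lives in the
  fraction field of the polynomial ring; the dynatomic polynomial is the unique polynomial that
  represents it. The product is only meaningful when no iterate occurring in it is the
  identity; for monic polynomials this can fail only in degree 1.
\<close>

definition dynatomic_fract :: "'a :: idom poly \<Rightarrow> nat \<Rightarrow> 'a poly fract" where
  "dynatomic_fract g n =
     (\<Prod>j | j dvd n. to_fract (poly_iter g j - [:0, 1:]) powi moebius_mu (n div j))"

definition dynatomic :: "'a :: idom poly \<Rightarrow> nat \<Rightarrow> 'a poly" where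
  "dynatomic g n = (THE P. to_fract P = dynatomic_fract g n)"

text \<open>
  The cyclotomic polynomial has coefficients in \<open>\<int>\<close> and is thus evaluated in an arbitrary ring
  via \<^const>\<open>of_int\<close>.
\<close>

definition cyclotomic :: "nat \<Rightarrow> int poly" where
  "cyclotomic n = (THE P. map_poly of_int P =
     (\<Prod>j | j \<in> {1..n} \<and> coprime j n. [:- cis (2 * pi * real j / real n), 1:]))"

definition cyclotomic_eval :: "nat \<Rightarrow> 'a :: comm_ring_1 \<Rightarrow> 'a" where
  "cyclotomic_eval n x = poly (map_poly of_int (cyclotomic n)) x"

definition emb :: "'a :: idom \<Rightarrow> 'a fract alg_closure" where
  "emb c = to_ac (to_fract c)"

abbreviation base_change :: "'a :: idom poly \<Rightarrow> 'a fract alg_closure poly" where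
  "base_change g \<equiv> map_poly emb g"

definition has_exact_period :: "('b \<Rightarrow> 'b) \<Rightarrow> 'b \<Rightarrow> nat \<Rightarrow> bool" where
  "has_exact_period h x k \<longleftrightarrow>
     k > 0 \<and> (h ^^ k) x = x \<and> (\<forall>j. 0 < j \<and> j < k \<longrightarrow> (h ^^ j) x \<noteq> x)"

definition multiplier :: "'a :: idom poly \<Rightarrow> nat \<Rightarrow> 'a fract alg_closure \<Rightarrow> 'a fract alg_closure" where
  "multiplier f k x = poly (pderiv (base_change (poly_iter f k))) x"

definition part_of :: "nat \<Rightarrow> nat \<Rightarrow> nat" where
  "part_of k m = (\<Prod>p\<in>prime_factors k. p ^ multiplicity p m)"

text \<open>Primes not dividing \<open>m\<close> contribute the factor 1 and are omitted.\<close>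

definition part_prime_to :: "nat \<Rightarrow> nat \<Rightarrow> nat" where
  "part_prime_to k m = (\<Prod>p | p \<in> prime_factors m \<and> \<not> p dvd k. p ^ multiplicity p m)"

lemma part_of_times_part_prime_to:
  assumes "k > 0" "m > 0" "k dvd m"
  shows "part_of k m * part_prime_to k m = m"
proof -
  have sub: "prime_factors k \<subseteq> prime_factors m"
    using assms by (simp add: dvd_prime_factors)
  have eq: "{p. p \<in> prime_factors m \<and> \<not> p dvd k} = prime_factors m - prime_factors k"
    using assms by (auto simp: in_prime_factors_iff)
  have "m = (\<Prod>p\<in>prime_factors m. p ^ multiplicity p m)"
    using assms by (simp add: prod_prime_factors)
  also have "\<dots> = part_prime_to k m * part_of k m"
    unfolding part_of_def part_prime_to_def eq by (rule prod.subset_diff[OF sub]) auto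
  finally show ?thesis by (simp add: mult.commute)
qed

lemma part_prime_to_gt_1:
  assumes "m > 0" "prime p" "p dvd m" "\<not> p dvd k"
  shows "part_prime_to k m > 1"
proof -
  have "p \<in> {p. p \<in> prime_factors m \<and> \<not> p dvd k}"
    using assms by (auto simp: in_prime_factors_iff)
  then have "p ^ multiplicity p m dvd part_prime_to k m"
    unfolding part_prime_to_def by (intro dvd_prodI) auto
  moreover have "p dvd p ^ multiplicity p m"
    using assms by (intro dvd_power) (auto simp: prime_multiplicity_gt_zero_iff)
  ultimately have "p dvd part_prime_to k m" by (rule dvd_trans[rotated])
  moreover have "part_prime_to k m > 0"
    unfolding part_prime_to_def by (intro prod_pos) (auto simp: in_prime_factors_iff prime_gt_0_nat)
  ultimately show ?thesis
    using prime_gt_1_nat[OF assms(2)] by (meson dvd_imp_le less_le_trans)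
qed

end

theory Submission
  imports Defs "Subresultants.More_Homomorphisms"
begin

text \<open>
  Write \<open>F\<^sub>n = f\<^sup>n - z\<close> for the \<open>n\<close>-th period polynomial, where \<open>f\<^sup>n\<close> is an iterate. By Moebius
  inversion, the dynatomic polynomials \<open>P\<^sub>d\<close> of \<open>f\<close> are determined by \<open>\<Prod>\<^bsub>d | n\<^esub> P\<^sub>d = F\<^sub>n\<close> for all
  \<open>n > 0\<close>, provided that the \<open>F\<^sub>n\<close> do not vanish and that polynomials \<open>P\<^sub>d\<close> satisfying these
  equations exist at all. All of the proof is phrased with this family of equations.

  Existence. If \<open>q\<close> divides \<open>F\<^sub>i\<close>, then \<open>F\<^bsub>i+j\<^esub>\<close> is congruent to \<open>F\<^sub>j\<close> modulo \<open>q\<close>. Hence for a fixed power \<open>q\<close> of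
  a linear factor, the positive indices \<open>n\<close> with \<open>q\<close> dividing \<open>F\<^sub>n\<close> are exactly the multiples of the
  least such index. Over an algebraically closed field, sorting the powers of the linear factors of
  all \<open>F\<^sub>n\<close> by that least index gives the \<open>P\<^sub>d\<close> (\<open>rank_of_apparition_factors\<close>). They have
  coefficients in the original domain because quotients by monic polynomials do
  (\<open>divisor_factors_descend\<close>). The argument is the same in every characteristic. Descent also
  gives the integrality of cyclotomic polynomials, starting from \<open>x\<^sup>n - 1\<close>.

  First equation. For coprime \<open>a\<close> and \<open>n\<close>, the divisors of \<open>a n\<close> are the products of divisors of \<open>a\<close>
  and \<open>n\<close>, so the polynomials \<open>\<Prod>\<^bsub>d | a\<^esub> P\<^bsub>d n\<^esub>\<close> satisfy the equations that characterise the
  dynatomic polynomials of the iterate \<open>f\<^sup>a\<close> (\<open>dynatomic_poly_iter_coprime\<close>).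

  Second equation. The point \<open>\<alpha>\<close> is fixed by \<open>g = f\<^sup>a\<close> with \<open>a\<close> the \<open>k\<close>-part of \<open>m\<close>, and by the chain
  rule \<open>g\<close> has derivative \<open>x = \<lambda>\<^bsup>a/k\<^esup>\<close> there. Every period polynomial of \<open>g\<close> is divisible by \<open>z - \<alpha>\<close>, and
  the quotient of the \<open>n\<close>-th one takes the value \<open>x\<^sup>n - 1\<close> at \<open>\<alpha>\<close>. Cancelling the factor
  \<open>z - \<alpha>\<close>, which comes from \<open>P\<^sub>1\<close>, shows that the values \<open>P\<^sub>n(\<alpha>)\<close> for \<open>n > 1\<close> solve the same
  divisor product equations as the cyclotomic values at \<open>x\<close>. If \<open>x\<close> is not a root of unity, all
  \<open>x\<^sup>n - 1\<close> are nonzero and the solution is unique (\<open>dynatomic_at_fixed_point_generic\<close>).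
  A root of unity \<open>x\<close> is replaced by a transcendental element by passing to \<open>g + t (z - \<alpha>)\<close> over a polynomial ring in
  \<open>t\<close>, which still fixes \<open>\<alpha>\<close> and has derivative \<open>x + t\<close> there; dynatomic polynomials commute with the
  specialisation \<open>t = 0\<close> (\<open>map_dynatomic\<close>, \<open>dynatomic_at_fixed_point\<close>).
\<close>

text \<open>
  This rule rewrites the constant \<open>[:1:]\<close> to \<open>1\<close> inside \<open>[:a, 1:]\<close>, after which facts about linear
  polynomials no longer match.
\<close>

declare coeff_lift_hom.hom_one [simp del]

section \<open>Moebius inversion over divisors\<close>

lemma prime_factors_prod_primes:
  fixes S :: "nat set"
  assumes "finite S" "\<And>p. p \<in> S \<Longrightarrow> prime p"
  shows "prime_factors (\<Prod>S) = S"
  using assms by (subst prime_factors_prod)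
    (auto simp: prime_factorization_prime dest: prime_gt_0_nat)

lemma bij_betw_squarefree_divisors:
  assumes "n > 0"
  shows "bij_betw (\<lambda>S. \<Prod>S) (Pow (prime_factors n)) {d :: nat. d dvd n \<and> squarefree d}"
proof (rule bij_betw_byWitness[where f' = prime_factors])
  have "prime_factors (\<Prod>S) = S" if "S \<subseteq> prime_factors n" for S :: "nat set"
    using that finite_subset[OF that] by (intro prime_factors_prod_primes) auto
  then show "\<forall>S\<in>Pow (prime_factors n). prime_factors (\<Prod>S) = S" by blast
  have radical: "\<Prod>(prime_factors d) = d" if "squarefree d" for d :: nat
  proof -
    have "d \<noteq> 0" using that by (metis not_squarefree_0)
    then have "d = (\<Prod>p\<in>prime_factors d. p ^ multiplicity p d)"
      by (simp add: prod_prime_factors)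
    also have "\<dots> = (\<Prod>p\<in>prime_factors d. p)"
      using that \<open>d \<noteq> 0\<close> by (intro prod.cong) (auto simp: squarefree_factorial_semiring')
    finally show ?thesis by simp
  qed
  then show "\<forall>d\<in>{d. d dvd n \<and> squarefree d}. \<Prod>(prime_factors d) = d" by blast
  show "(\<lambda>S. \<Prod>S) ` Pow (prime_factors n) \<subseteq> {d. d dvd n \<and> squarefree d}"
  proof safe
    fix S assume S: "S \<subseteq> prime_factors n"
    have "finite S" using S finite_subset by blast
    have pr: "\<And>p. p \<in> S \<Longrightarrow> prime p" using S by auto
    have "\<Prod>S dvd \<Prod>(prime_factors n)"
      using S by (intro prod_dvd_prod_subset) auto
    also have "\<dots> dvd (\<Prod>p\<in>prime_factors n. p ^ multiplicity p n)"
      by (intro prod_dvd_prod dvd_power) (auto simp: prime_factors_multiplicity)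
    also have "\<dots> = n" using assms by (simp add: prod_prime_factors)
    finally show "\<Prod>S dvd n" .
    show "squarefree (\<Prod>S)"
      using pr by (intro squarefree_prod_coprime) (auto intro: primes_coprime squarefree_prime)
  qed
  show "prime_factors ` {d. d dvd n \<and> squarefree d} \<subseteq> Pow (prime_factors n)"
    using assms by (auto dest: dvd_prime_factors[rotated])
qed

text \<open>Only squarefree divisors contribute. They correspond to sets of prime factors, and the alternating
  sum over all subsets of a set is an empty product or a product of zeros.\<close>

lemma sum_moebius_mu_divisors:
  assumes "n > 0"
  shows "(\<Sum>d | d dvd n. moebius_mu d) = (if n = 1 then 1 else 0)"
proof -
  have "(\<Sum>d | d dvd n. moebius_mu d) = (\<Sum>d | d dvd n \<and> squarefree d. moebius_mu d)"
    using assms by (intro sum.mono_neutral_right) (auto simp: moebius_mu_def)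
  also have "\<dots> = (\<Sum>S\<in>Pow (prime_factors n). moebius_mu (\<Prod>S))"
    by (rule sum.reindex_bij_betw[symmetric, OF bij_betw_squarefree_divisors[OF assms]])
  also have "\<dots> = (\<Sum>S\<in>Pow (prime_factors n). (-1) ^ card S)"
  proof (rule sum.cong[OF refl])
    fix S assume S: "S \<in> Pow (prime_factors n)"
    then have "\<Prod>S \<in> {d. d dvd n \<and> squarefree d}"
      using bij_betw_squarefree_divisors[OF assms] by (auto simp: bij_betw_def)
    moreover have "prime_factors (\<Prod>S) = S"
      using S finite_subset by (intro prime_factors_prod_primes) auto
    ultimately show "moebius_mu (\<Prod>S) = (-1) ^ card S" by (simp add: moebius_mu_def)
  qed
  also have "\<dots> = (\<Prod>p\<in>prime_factors n. 1 - 1)"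
    by (subst prod_diff_conv_sum) auto
  also have "\<dots> = (if n = 1 then 1 else 0)"
  proof (cases "n = 1")
    case False
    then have "prime_factors n \<noteq> {}"
      using assms by (simp add: prime_factorization_empty_iff)
    then show ?thesis using False by (simp add: card_gt_0_iff)
  qed simp
  finally show ?thesis .
qed

lemma power_int_prod_base:
  "(\<Prod>x\<in>A. f x :: 'a :: field) powi k = (\<Prod>x\<in>A. f x powi k)"
  by (induction A rule: infinite_finite_induct) (auto simp: power_int_mult_distrib)

lemma power_int_sum_exponent:
  "c \<noteq> 0 \<Longrightarrow> (c :: 'a :: field) powi (\<Sum>x\<in>A. e x) = (\<Prod>x\<in>A. c powi e x)"
  by (induction A rule: infinite_finite_induct) (auto simp: power_int_add)

text \<open>After exchanging the products, the exponent of \<open>v d\<close> is the sum of the Moebius function over the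
  divisors of \<open>n div d\<close>, which vanishes unless \<open>d = n\<close>.\<close>

lemma moebius_inversion_powi:
  fixes v :: "nat \<Rightarrow> 'a :: field"
  assumes n: "n > 0" and nz: "\<And>d. d dvd n \<Longrightarrow> v d \<noteq> 0"
  shows "(\<Prod>j | j dvd n. (\<Prod>d | d dvd j. v d) powi moebius_mu (n div j)) = v n"
proof -
  have fin: "finite {d. d dvd n}" using n by simp
  have "(\<Prod>j | j dvd n. (\<Prod>d | d dvd j. v d) powi moebius_mu (n div j))
      = (\<Prod>j | j dvd n. \<Prod>d | d \<in> {d. d dvd n} \<and> d dvd j. v d powi moebius_mu (n div j))"
    unfolding power_int_prod_base
    by (intro prod.cong refl) (auto intro: dvd_trans)
  also have "\<dots> = (\<Prod>d | d dvd n. \<Prod>j | j \<in> {j. j dvd n} \<and> d dvd j. v d powi moebius_mu (n div j))"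
    by (rule prod.swap_restrict[OF fin fin])
  also have "\<dots> = (\<Prod>d | d dvd n. if d = n then v d else 1)"
  proof (rule prod.cong[OF refl])
    fix d assume "d \<in> {d. d dvd n}"
    then obtain c where c: "n = d * c" by auto
    with n have pos: "d > 0" "c > 0" by auto
    have "bij_betw (\<lambda>j. n div j) {j. j dvd n \<and> d dvd j} {e. e dvd c}"
    proof (rule bij_betw_byWitness[where f' = "\<lambda>e. n div e"])
      show "\<forall>j\<in>{j. j dvd n \<and> d dvd j}. n div (n div j) = j"
        using n by (auto elim!: dvdE)
      show "\<forall>e\<in>{e. e dvd c}. n div (n div e) = e"
        using n c by (auto elim!: dvdE)
      show "(\<lambda>j. n div j) ` {j. j dvd n \<and> d dvd j} \<subseteq> {e. e dvd c}"
        using n pos unfolding c by (auto elim!: dvdE simp: mult.assoc)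
      show "(\<lambda>e. n div e) ` {e. e dvd c} \<subseteq> {j. j dvd n \<and> d dvd j}"
        using n pos unfolding c by (auto elim!: dvdE)
    qed
    then have "(\<Sum>j | j dvd n \<and> d dvd j. moebius_mu (n div j)) = (\<Sum>e | e dvd c. moebius_mu e)"
      by (rule sum.reindex_bij_betw)
    also have "\<dots> = (if d = n then 1 else 0)"
      using sum_moebius_mu_divisors[OF pos(2)] c pos by auto
    finally show "(\<Prod>j | j \<in> {j. j dvd n} \<and> d dvd j. v d powi moebius_mu (n div j))
        = (if d = n then v d else 1)"
      using nz[of d] c by (simp add: power_int_sum_exponent[symmetric])
  qed
  also have "\<dots> = v n"
    using fin by simp
  finally show ?thesis .
qed

lemma divisor_product_split_self:
  fixes v :: "nat \<Rightarrow> 'a :: comm_monoid_mult"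
  assumes "n > 0"
  shows "(\<Prod>d | d dvd n. v d) = v n * (\<Prod>d | d dvd n \<and> d \<noteq> n. v d)"
proof -
  have "{d. d dvd n} = insert n {d. d dvd n \<and> d \<noteq> n}" by auto
  moreover have "finite {d. d dvd n \<and> d \<noteq> n}" using assms by simp
  ultimately show ?thesis by simp
qed

text \<open>The equation for \<open>n\<close> determines \<open>p n\<close> from the values at proper divisors, as long as their product
  can be cancelled. Only the equations at divisors of \<open>n\<close> enter the recursion.\<close>

lemma divisor_product_unique:
  fixes p q :: "nat \<Rightarrow> 'a :: idom"
  assumes "n > 0"
    and "\<And>j. j dvd n \<Longrightarrow> (\<Prod>d | d dvd j. p d) = (\<Prod>d | d dvd j. q d)"
    and "\<And>j. j dvd n \<Longrightarrow> (\<Prod>d | d dvd j. q d) \<noteq> 0"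
  shows "p n = q n"
  using assms
proof (induction n rule: less_induct)
  case (less n)
  have eq: "(\<Prod>d | d dvd n \<and> d \<noteq> n. p d) = (\<Prod>d | d dvd n \<and> d \<noteq> n. q d)"
  proof (intro prod.cong refl, safe)
    fix d assume d: "d dvd n" "d \<noteq> n"
    then have "d < n" "d > 0" using less.prems(1) by (auto dest: dvd_imp_le intro: Nat.gr0I)
    then show "p d = q d"
      using d less.prems(2,3) by (intro less.IH) (auto intro: dvd_trans)
  qed
  show ?case
    using less.prems(2)[of n] less.prems(3)[of n]
    by (simp add: divisor_product_split_self[OF less.prems(1)] eq)
qed

section \<open>Factoring strong divisibility sequences of polynomials\<close>

text \<open>Division with remainder by a monic polynomial is possible over the smaller domain. Over the larger
  one, the remainder becomes a multiple of the divisor of smaller degree, hence zero.\<close>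

lemma monic_division_descends:
  fixes D U :: "'a :: idom poly" and V :: "'b :: idom poly"
  assumes "inj_idom_hom h" and monic: "lead_coeff D = 1"
    and eq: "map_poly h D * V = map_poly h U"
  shows "\<exists>W. map_poly h W = V"
proof -
  interpret H: inj_idom_hom h by fact
  interpret P: map_poly_inj_idom_hom h ..
  have "D \<noteq> 0" using monic by auto
  obtain q r where qr: "pseudo_divmod U D = (q, r)" by fastforce
  have U: "U = D * q + r" and r: "r = 0 \<or> degree r < degree D"
    using pseudo_divmod[OF \<open>D \<noteq> 0\<close> qr] monic by auto
  have eq': "map_poly h D * (V - map_poly h q) = map_poly h r"
    using eq unfolding U by (simp add: hom_distribs algebra_simps)
  have "V - map_poly h q = 0"
  proof (rule ccontr)
    assume nz: "V - map_poly h q \<noteq> 0"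
    then have "degree (map_poly h r) = degree D + degree (V - map_poly h q)"
      unfolding eq'[symmetric] using \<open>D \<noteq> 0\<close> by (subst degree_mult_eq) auto
    moreover have "r \<noteq> 0" using eq' nz \<open>D \<noteq> 0\<close> by auto
    ultimately show False using r by auto
  qed
  then show ?thesis by auto
qed

text \<open>By induction, \<open>v n\<close> is the quotient of \<open>u n\<close> by the product of the \<open>v d\<close> over proper divisors, which
  is monic and already known to have coefficients in the smaller domain.\<close>

lemma divisor_factors_descend:
  fixes u :: "nat \<Rightarrow> 'a :: idom poly" and v :: "nat \<Rightarrow> 'b :: idom poly"
  assumes h: "inj_idom_hom h"
    and monic: "\<And>n. n > 0 \<Longrightarrow> lead_coeff (v n) = 1"
    and prod: "\<And>n. n > 0 \<Longrightarrow> (\<Prod>d | d dvd n. v d) = map_poly h (u n)"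
  obtains w where "\<And>n. n > 0 \<Longrightarrow> map_poly h (w n) = v n"
    and "\<And>n. n > 0 \<Longrightarrow> (\<Prod>d | d dvd n. w d) = u n"
proof -
  interpret H: inj_idom_hom h by fact
  interpret P: map_poly_inj_idom_hom h ..
  have ex: "\<exists>W. map_poly h W = v n" if "n > 0" for n
    using that
  proof (induction n rule: less_induct)
    case (less n)
    have proper: "d < n \<and> 0 < d" if "d dvd n" "d \<noteq> n" for d
      using that less.prems by (auto dest: dvd_imp_le intro: Nat.gr0I)
    have "\<exists>w. \<forall>d\<in>{d. d dvd n \<and> d \<noteq> n}. map_poly h (w d) = v d"
      using less.IH proper by (intro bchoice) auto
    then obtain w where w: "\<And>d. d dvd n \<Longrightarrow> d \<noteq> n \<Longrightarrow> map_poly h (w d) = v d" by blast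
    define D where "D = (\<Prod>d | d dvd n \<and> d \<noteq> n. w d)"
    have hD: "map_poly h D = (\<Prod>d | d dvd n \<and> d \<noteq> n. v d)"
      unfolding D_def P.hom_prod using w by (intro prod.cong) auto
    have "h (lead_coeff D) = lead_coeff (map_poly h D)" by simp
    also have "\<dots> = 1"
      unfolding hD lead_coeff_prod using proper by (intro prod.neutral) (auto intro: monic)
    finally have "lead_coeff D = 1" by simp
    moreover have "map_poly h D * v n = map_poly h (u n)"
      using prod[OF less.prems] divisor_product_split_self[OF less.prems, of v]
      by (simp add: hD mult.commute)
    ultimately show ?case by (rule monic_division_descends[OF h])
  qed
  then have "\<exists>w. \<forall>n\<in>{0<..}. map_poly h (w n) = v n" by (intro bchoice) auto
  then obtain w where w: "\<And>n. n > 0 \<Longrightarrow> map_poly h (w n) = v n" by auto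
  have "(\<Prod>d | d dvd n. w d) = u n" if n: "n > 0" for n
  proof -
    have "map_poly h (\<Prod>d | d dvd n. w d) = (\<Prod>d | d dvd n. v d)"
      unfolding P.hom_prod using n by (intro prod.cong) (auto intro!: w intro: Nat.gr0I)
    then show ?thesis by (simp add: prod[OF n])
  qed
  with w show thesis by (rule that)
qed

lemma monic_eq_prod_roots:
  fixes p :: "'a :: alg_closed_field poly"
  assumes "lead_coeff p = 1"
  shows "p = (\<Prod>a | poly p a = 0. [:- a, 1:] ^ order a p)"
proof -
  have "p \<noteq> 0" using assms by auto
  obtain A where A: "p = (\<Prod>x\<in>#A. [:- x, 1:])"
    using alg_closed_imp_factorization[OF \<open>p \<noteq> 0\<close>] assms by auto
  have ord: "order a (\<Prod>x\<in>#M. [:- x, 1:]) = count M a" for a and M :: "'a multiset"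
  proof (induction M)
    case (add x M)
    have "(\<Prod>x\<in>#M. [:- x, 1:]) \<noteq> 0" by (auto simp: prod_mset_zero_iff)
    then have "[:- x, 1:] * (\<Prod>x\<in>#M. [:- x, 1:]) \<noteq> 0"
      by (simp only: mult_eq_0_iff) simp
    moreover have "order a [:- x, 1:] = (if x = a then 1 else 0)"
      using order_power_n_n[of a 1] by (auto intro: order_0I)
    ultimately show ?case using add.IH by (simp del: mult_pCons_left add: order_mult)
  qed simp
  have "{a. poly p a = 0} = set_mset A"
    using \<open>p \<noteq> 0\<close> ord[of _ A] by (auto simp: order_root A[symmetric])
  moreover have "p = (\<Prod>a\<in>set_mset A. [:- a, 1:] ^ count A a)"
    unfolding A by (simp add: image_prod_mset_multiplicity)
  ultimately show ?thesis using ord[of _ A] by (simp add: A[symmetric])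
qed

text \<open>The hypothesis \<open>shift\<close> makes \<open>u\<close> a strong divisibility sequence: the positive indices \<open>n\<close> with
  \<open>q dvd u n\<close> are the multiples of the least one, the rank of apparition of \<open>q\<close>. In the
  decomposition \<open>v\<close>, each power \<open>[:- a, 1:] ^ t\<close> with \<open>t > 0\<close> dividing some \<open>u n\<close> contributes one factor
  \<open>[:- a, 1:]\<close> to the \<open>v d\<close> with \<open>d\<close> its rank. The multiplicity of \<open>a\<close> in \<open>u n\<close> counts the exponents
  whose rank divides \<open>n\<close>, so it is the sum of the multiplicities of \<open>a\<close> in the \<open>v d\<close> over the divisors of \<open>n\<close>.\<close>

lemma rank_of_apparition_factors:
  fixes u :: "nat \<Rightarrow> 'a :: alg_closed_field poly"
  assumes monic: "\<And>n. n > 0 \<Longrightarrow> lead_coeff (u n) = 1"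
    and zero: "u 0 = 0"
    and shift: "\<And>q i j. q dvd u i \<Longrightarrow> q dvd u (i + j) \<longleftrightarrow> q dvd u j"
  obtains v where "\<And>n. n > 0 \<Longrightarrow> lead_coeff (v n) = 1"
    and "\<And>n. n > 0 \<Longrightarrow> (\<Prod>d | d dvd n. v d) = u n"
proof -
  \<comment> \<open>exponents of powers of the linear factor at \<open>a\<close> that have rank of apparition \<open>d\<close>\<close>
  define T where "T a d = {t. 0 < t \<and> [:- a, 1:] ^ t dvd u d \<and>
      (\<forall>e. 0 < e \<and> e < d \<longrightarrow> \<not> [:- a, 1:] ^ t dvd u e)}" for a d
  define v where "v d = (\<Prod>a | poly (u d) a = 0. [:- a, 1:] ^ card (T a d))" for d
  have nz: "u n \<noteq> 0" if "n > 0" for n using monic[OF that] by auto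
  have multiples: "q dvd u (r * c)" if "q dvd u r" for q r c
    using that by (induction c) (auto simp: zero shift)
  have "(\<Prod>d | d dvd n. v d) = u n" if n: "n > 0" for n
  proof -
    have pos: "d > 0" if "d dvd n" for d using that n by (auto intro: Nat.gr0I)
    have "v d = (\<Prod>a | poly (u n) a = 0. [:- a, 1:] ^ card (T a d))" if d: "d dvd n" for d
      unfolding v_def
    proof (rule prod.mono_neutral_left)
      show "finite {a. poly (u n) a = 0}" using nz[OF n] by (rule poly_roots_finite)
      have "u d dvd u n" using d multiples[of "u d" d] by auto
      then show "{a. poly (u d) a = 0} \<subseteq> {a. poly (u n) a = 0}" by auto
      have "T a d = {}" if "poly (u d) a \<noteq> 0" for a
      proof -
        have "\<not> [:- a, 1:] ^ t dvd u d" if "t > 0" for t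
          using that \<open>poly (u d) a \<noteq> 0\<close> dvd_trans[OF dvd_power[of t "[:- a, 1:]"], of "u d"]
          by (auto simp: poly_eq_0_iff_dvd)
        then show ?thesis by (auto simp: T_def)
      qed
      then show "\<forall>a\<in>{a. poly (u n) a = 0} - {a. poly (u d) a = 0}.
          [:- a, 1:] ^ card (T a d) = 1" by simp
    qed
    then have "(\<Prod>d | d dvd n. v d)
        = (\<Prod>d | d dvd n. \<Prod>a | poly (u n) a = 0. [:- a, 1:] ^ card (T a d))"
      by (intro prod.cong) auto
    also have "\<dots> = (\<Prod>a | poly (u n) a = 0. [:- a, 1:] ^ (\<Sum>d | d dvd n. card (T a d)))"
      by (subst prod.swap) (simp add: power_sum)
    also have "\<dots> = (\<Prod>a | poly (u n) a = 0. [:- a, 1:] ^ order a (u n))"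
    proof (rule prod.cong[OF refl])
      fix a
      have T_sub: "T a d \<subseteq> {0<..order a (u n)}" if "d dvd n" for d
      proof -
        have "u d dvd u n" using that multiples[of "u d" d] by auto
        show ?thesis
          using nz[OF n] order_divides[of a _ "u n"] by (auto simp: T_def dest!: dvd_trans[OF _ \<open>u d dvd u n\<close>])
      qed
      have "{0<..order a (u n)} \<subseteq> (\<Union>d\<in>{d. d dvd n}. T a d)"
      proof
        fix t assume "t \<in> {0<..order a (u n)}"
        then have t: "t > 0" "[:- a, 1:] ^ t dvd u n" using nz[OF n] by (auto simp: order_divides)
        define r where "r = (LEAST r. 0 < r \<and> [:- a, 1:] ^ t dvd u r)"
        have r: "0 < r" "[:- a, 1:] ^ t dvd u r"
          using LeastI[of "\<lambda>r. 0 < r \<and> [:- a, 1:] ^ t dvd u r" n] t n unfolding r_def by auto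
        have least: "\<not> [:- a, 1:] ^ t dvd u e" if "0 < e" "e < r" for e
          using not_less_Least[of e "\<lambda>r. 0 < r \<and> [:- a, 1:] ^ t dvd u r"] that
          unfolding r_def by auto
        have "[:- a, 1:] ^ t dvd u (n mod r)"
          using shift[OF multiples[OF r(2)], of "n div r" "n mod r"] t by simp
        then have "n mod r = 0" using least[of "n mod r"] r(1) by auto
        then have "r dvd n" by auto
        moreover have "t \<in> T a r" using t(1) r least by (auto simp: T_def)
        ultimately show "t \<in> (\<Union>d\<in>{d. d dvd n}. T a d)" by blast
      qed
      with T_sub have union: "(\<Union>d\<in>{d. d dvd n}. T a d) = {0<..order a (u n)}" by blast
      have "T a d \<inter> T a e = {}" if "d dvd n" "e dvd n" "d \<noteq> e" for d e
        using that(3) pos[OF that(1)] pos[OF that(2)]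
        by (cases d e rule: linorder_cases) (auto simp: T_def)
      moreover have "finite (T a d)" if "d dvd n" for d
        using T_sub[OF that] finite_subset by blast
      ultimately have "(\<Sum>d | d dvd n. card (T a d)) = card (\<Union>d\<in>{d. d dvd n}. T a d)"
        using n by (intro card_UN_disjoint[symmetric]) auto
      then show "[:- a, 1:] ^ (\<Sum>d | d dvd n. card (T a d)) = [:- a, 1:] ^ order a (u n)"
        by (simp add: union)
    qed
    also have "\<dots> = u n" using monic_eq_prod_roots[OF monic[OF n]] by simp
    finally show ?thesis .
  qed
  moreover have "lead_coeff (v n) = 1" for n
    unfolding v_def lead_coeff_prod lead_coeff_power by simp
  ultimately show thesis using that by blast
qed

section \<open>Iterates and period polynomials\<close>

abbreviation period_poly :: "'a :: comm_ring_1 poly \<Rightarrow> nat \<Rightarrow> 'a poly" where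
  "period_poly g n \<equiv> poly_iter g n - [:0, 1:]"

lemma poly_iter_0 [simp]: "poly_iter g 0 = [:0, 1:]"
  by (simp add: poly_iter_def)

lemma poly_iter_Suc: "poly_iter g (Suc j) = g \<circ>\<^sub>p poly_iter g j"
  by (simp add: poly_iter_def)

lemma poly_iter_1 [simp]: "poly_iter g (Suc 0) = g"
  by (simp add: poly_iter_Suc)

lemma poly_iter_add: "poly_iter g (i + j) = poly_iter g i \<circ>\<^sub>p poly_iter g j"
  by (induction i) (simp_all add: poly_iter_Suc pcompose_pCons pcompose_assoc)

lemma poly_iter_mult: "poly_iter g (a * b) = poly_iter (poly_iter g a) b"
  by (induction b) (simp_all add: poly_iter_Suc poly_iter_add)

lemma poly_poly_iter: "poly (poly_iter g j) x = (poly g ^^ j) x"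
  by (induction j) (simp_all add: poly_iter_Suc poly_pcompose)

lemma degree_poly_iter: "degree (poly_iter (g :: 'a :: idom poly) j) = degree g ^ j"
  by (induction j) (simp_all add: poly_iter_Suc degree_pcompose)

lemma poly_iter_constant: "j > 0 \<Longrightarrow> poly_iter [:c:] j = [:c:]"
  by (cases j) (simp_all add: poly_iter_Suc)

lemma monic_degree_0: "lead_coeff g = 1 \<Longrightarrow> degree g = 0 \<Longrightarrow> g = [:1:]"
  by (metis degree_0_id)

lemma monic_poly_iter:
  fixes g :: "'a :: idom poly"
  assumes "lead_coeff g = 1"
  shows "lead_coeff (poly_iter g j) = 1"
proof (cases "degree g = 0")
  case True
  then have "g = [:1:]" using assms by (rule monic_degree_0[rotated])
  then show ?thesis by (cases j) (simp_all add: poly_iter_constant)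
next
  case False
  show ?thesis
  proof (induction j)
    case (Suc j)
    have "degree (poly_iter g j) > 0" using False by (simp add: degree_poly_iter)
    then show ?case
      using Suc assms by (simp only: poly_iter_Suc lead_coeff_comp) simp
  qed simp
qed

lemma monic_period_poly:
  fixes g :: "'a :: idom poly"
  assumes "lead_coeff g = 1" "degree g > 1" "n > 0"
  shows "lead_coeff (period_poly g n) = 1"
proof -
  have "degree g ^ 1 \<le> degree g ^ n"
    using assms by (intro power_increasing) auto
  then have deg: "degree [:0, 1 :: 'a:] < degree (poly_iter g n)"
    using assms by (simp add: degree_poly_iter)
  then have "lead_coeff (- [:0, 1:] + poly_iter g n) = lead_coeff (poly_iter g n)"
    by (intro lead_coeff_add_le) simp
  then show ?thesis using monic_poly_iter[OF assms(1), of n] by (simp del: minus_pCons)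
qed

lemma period_poly_nonzero:
  fixes g :: "'a :: idom poly"
  assumes "lead_coeff g = 1" "degree g \<noteq> 1" "n > 0"
  shows "period_poly g n \<noteq> 0"
proof (cases "degree g = 0")
  case True
  then show ?thesis using monic_degree_0[OF assms(1)] assms(3) by (simp add: poly_iter_constant)
next
  case False
  then have "lead_coeff (period_poly g n) = 1" using assms by (intro monic_period_poly) auto
  then show ?thesis by auto
qed

lemma diff_dvd_pcompose_diff: "p - r dvd g \<circ>\<^sub>p p - g \<circ>\<^sub>p (r :: 'a :: comm_ring_1 poly)"
proof (induction g)
  case (pCons a g)
  have "pCons a g \<circ>\<^sub>p p - pCons a g \<circ>\<^sub>p r = p * (g \<circ>\<^sub>p p - g \<circ>\<^sub>p r) + (p - r) * (g \<circ>\<^sub>p r)"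
    by (simp add: pcompose_pCons algebra_simps)
  with pCons.IH show ?case by simp
qed simp

text \<open>Modulo \<open>q\<close>, the \<open>i\<close>-th iterate is the identity, so composing with it does not change the \<open>j\<close>-th one.\<close>

lemma period_poly_shift:
  fixes g :: "'a :: comm_ring_1 poly"
  assumes "q dvd period_poly g i"
  shows "q dvd period_poly g (i + j) \<longleftrightarrow> q dvd period_poly g j"
proof -
  have "q dvd poly_iter g j \<circ>\<^sub>p poly_iter g i - poly_iter g j \<circ>\<^sub>p [:0, 1:]"
    using assms diff_dvd_pcompose_diff by (rule dvd_trans)
  then have "q dvd period_poly g (i + j) - period_poly g j"
    by (simp add: poly_iter_add[of g j i, unfolded add.commute[of j i]])
  then show ?thesis by (metis diff_add_cancel dvd_add_right_iff)
qed

lemma map_poly_iter: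
  assumes "comm_ring_hom h"
  shows "map_poly h (poly_iter g j) = poly_iter (map_poly h g) j"
proof -
  interpret comm_ring_hom h by fact
  show ?thesis by (induction j) (simp_all add: poly_iter_Suc map_poly_pcompose map_poly_pCons_hom)
qed

lemma map_period_poly:
  assumes "comm_ring_hom h"
  shows "map_poly h (period_poly g j) = period_poly (map_poly h g) j"
proof -
  interpret H: comm_ring_hom h by fact
  interpret P: map_poly_comm_ring_hom h ..
  show ?thesis by (simp add: P.hom_minus map_poly_iter[OF assms] H.map_poly_pCons_hom)
qed

lemma pderiv_poly_iter_at_fixed_point:
  fixes g :: "'a :: idom poly"
  assumes "poly g x = x"
  shows "poly (pderiv (poly_iter g j)) x = poly (pderiv g) x ^ j"
proof (induction j)
  case (Suc j)
  have "(poly g ^^ j) x = x" using assms by (induction j) auto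
  then show ?case
    using Suc by (simp add: poly_iter_Suc pderiv_pcompose poly_pcompose poly_poly_iter)
qed (simp add: pderiv_pCons)

section \<open>Existence of dynatomic polynomials\<close>

text \<open>The product equations say what the alternating product defining \<open>dynatomic_fract\<close> is: Moebius
  inversion in the fraction field evaluates it to a polynomial, which therefore is the dynatomic
  polynomial.\<close>

lemma dynatomic_eqI:
  fixes g :: "'a :: idom poly"
  assumes n: "n > 0"
    and prod: "\<And>j. j dvd n \<Longrightarrow> (\<Prod>d | d dvd j. w d) = period_poly g j"
    and nz: "\<And>j. j dvd n \<Longrightarrow> period_poly g j \<noteq> 0"
  shows "dynatomic g n = w n"
proof -
  have w_nz: "to_fract (w d) \<noteq> 0" if "d dvd n" for d
  proof -
    have "d > 0" using that n by (auto intro: Nat.gr0I)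
    then show ?thesis
      using prod[OF that] nz[OF that] by (auto simp: divisor_product_split_self)
  qed
  have "dynatomic_fract g n
      = (\<Prod>j | j dvd n. (\<Prod>d | d dvd j. to_fract (w d)) powi moebius_mu (n div j))"
    unfolding dynatomic_fract_def
    by (intro prod.cong refl) (simp del: to_fract_diff add: prod[symmetric] to_fract_hom.hom_prod)
  also have "\<dots> = to_fract (w n)"
    using n w_nz by (rule moebius_inversion_powi)
  finally show ?thesis unfolding dynatomic_def by (intro the_equality) auto
qed

lemma emb_hom: "inj_idom_hom emb"
  by unfold_locales (simp_all add: emb_def)

text \<open>In degree at least 2 the period polynomials are monic and form
  a strong divisibility sequence over the algebraic closure, so they factor there and the factors descend. In
  degree 0 the polynomial is \<open>1\<close> and every period polynomial is \<open>1 - z\<close>.\<close>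

lemma prod_dynatomic:
  fixes f :: "'a :: idom poly"
  assumes monic: "lead_coeff f = 1" and deg: "degree f \<noteq> 1" and n: "n > 0"
  shows "(\<Prod>d | d dvd n. dynatomic f d) = period_poly f n"
proof -
  have "\<exists>w. \<forall>n>0. (\<Prod>d | d dvd n. w d) = period_poly f n"
  proof (cases "degree f = 0")
    case True
    let ?w = "\<lambda>d :: nat. if d = 1 then [:1, - 1 :: 'a:] else 1"
    have "(\<Prod>d | d dvd n. ?w d) = period_poly f n" if "n > 0" for n
      using that monic_degree_0[OF monic True] by (simp add: poly_iter_constant)
    then show ?thesis by blast
  next
    case False
    interpret H: inj_idom_hom "emb :: 'a \<Rightarrow> _" by (rule emb_hom)
    have hom: "comm_ring_hom (emb :: 'a \<Rightarrow> _)" ..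
    have F: "lead_coeff (base_change f) = 1" "degree (base_change f) > 1"
      using monic deg False by simp_all
    obtain v where v: "\<And>n. n > 0 \<Longrightarrow> lead_coeff (v n) = 1"
      "\<And>n. n > 0 \<Longrightarrow> (\<Prod>d | d dvd n. v d) = period_poly (base_change f) n"
    proof (rule rank_of_apparition_factors[of "period_poly (base_change f)"])
      show "lead_coeff (period_poly (base_change f) n) = 1" if "n > 0" for n
        using F that by (rule monic_period_poly)
    next
      show "q dvd period_poly (base_change f) (i + j) \<longleftrightarrow> q dvd period_poly (base_change f) j"
        if "q dvd period_poly (base_change f) i" for q i j
        using that by (rule period_poly_shift)
    qed (simp, blast)
    obtain w where "\<And>n. n > 0 \<Longrightarrow> (\<Prod>d | d dvd n. w d) = period_poly f n"
    proof (rule divisor_factors_descend[OF emb_hom, of v "period_poly f"])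
      show "(\<Prod>d | d dvd n. v d) = base_change (period_poly f n)" if "n > 0" for n
        unfolding map_period_poly[OF hom] using that by (rule v(2))
    qed (use v(1) in auto)
    then show ?thesis by blast
  qed
  then obtain w where w: "\<And>n. n > 0 \<Longrightarrow> (\<Prod>d | d dvd n. w d) = period_poly f n" by blast
  have "dynatomic f d = w d" if "d > 0" for d
    using that w period_poly_nonzero[OF monic deg]
    by (intro dynatomic_eqI) (auto intro: Nat.gr0I)
  then have "(\<Prod>d | d dvd n. dynatomic f d) = (\<Prod>d | d dvd n. w d)"
    using n by (intro prod.cong) (auto intro: Nat.gr0I)
  then show ?thesis using w[OF n] by simp
qed

text \<open>The homomorphism may have a kernel: the product equations are preserved by it, and they
  still determine the factors since the image of a monic polynomial stays monic of the same degree.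
  This is what permits specialising a parameter.\<close>

lemma map_dynatomic:
  fixes f :: "'a :: idom poly" and h :: "'a \<Rightarrow> 'b :: idom"
  assumes "comm_ring_hom h" and monic: "lead_coeff f = 1" and deg: "degree f \<noteq> 1" and n: "n > 0"
  shows "map_poly h (dynatomic f n) = dynatomic (map_poly h f) n"
proof (rule dynatomic_eqI[symmetric])
  interpret H: comm_ring_hom h by fact
  interpret P: map_poly_comm_ring_hom h ..
  have "degree (map_poly h f) = degree f"
    by (rule map_poly_degree_eq) (simp add: monic)
  then have F: "lead_coeff (map_poly h f) = 1" "degree (map_poly h f) \<noteq> 1"
    using monic deg by simp_all
  fix j assume "j dvd n"
  then have j: "j > 0" using n by (auto intro: Nat.gr0I)
  show "(\<Prod>d | d dvd j. map_poly h (dynatomic f d)) = period_poly (map_poly h f) j"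
    by (simp only: P.hom_prod[symmetric] prod_dynatomic[OF monic deg j] map_period_poly[OF assms(1)])
  show "period_poly (map_poly h f) j \<noteq> 0" by (rule period_poly_nonzero[OF F j])
qed (rule n)

section \<open>Dynatomic polynomials of iterates\<close>

text \<open>A divisor \<open>e\<close> of \<open>a * b\<close> is the product of \<open>gcd e a\<close> and \<open>gcd e b\<close>.\<close>

lemma prod_divisors_coprime_mult:
  fixes a b :: nat and F :: "nat \<Rightarrow> 'c :: comm_monoid_mult"
  assumes "coprime a b" "a > 0" "b > 0"
  shows "(\<Prod>e | e dvd a * b. F e) = (\<Prod>c | c dvd b. \<Prod>d | d dvd a. F (d * c))"
proof -
  have "bij_betw (\<lambda>(c, d). d * c) ({c. c dvd b} \<times> {d. d dvd a}) {e. e dvd a * b}"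
  proof (rule bij_betw_byWitness[where f' = "\<lambda>e. (gcd e b, gcd e a)"])
    have "gcd (d * c) b = c" "gcd (d * c) a = d" if "c dvd b" "d dvd a" for c d
    proof -
      have "coprime b d" "coprime a c"
        using coprime_divisors[OF that(2) dvd_refl assms(1)] coprime_divisors[OF dvd_refl that(1) assms(1)]
        by (simp_all add: coprime_commute)
      then have "gcd (d * c) b = gcd c b" "gcd (d * c) a = gcd d a"
        by (simp_all add: gcd_mult_left_left_cancel gcd_mult_left_right_cancel)
      then show "gcd (d * c) b = c" "gcd (d * c) a = d"
        using that by (simp_all add: gcd_nat.absorb1)
    qed
    then show "\<forall>x\<in>{c. c dvd b} \<times> {d. d dvd a}. (\<lambda>e. (gcd e b, gcd e a)) ((\<lambda>(c, d). d * c) x) = x"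
      by auto
    show "\<forall>e\<in>{e. e dvd a * b}. (\<lambda>(c, d). d * c) (gcd e b, gcd e a) = e"
    proof clarify
      fix e assume "e dvd a * b"
      have "coprime (gcd e a) (gcd e b)"
        using coprime_divisors[OF gcd_dvd2 gcd_dvd2 assms(1)] .
      then have "gcd e a * gcd e b dvd e" by (intro divides_mult) auto
      moreover obtain d c where "e = d * c" "d dvd a" "c dvd b"
        using division_decomp[OF \<open>e dvd a * b\<close>] by blast
      then have "e dvd gcd e a * gcd e b"
        by (metis dvd_triv_left dvd_triv_right gcd_greatest mult_dvd_mono)
      ultimately show "gcd e a * gcd e b = e" by (rule dvd_antisym)
    qed
  qed (auto intro: mult_dvd_mono)
  then have "(\<Prod>e | e dvd a * b. F e) = (\<Prod>(c, d)\<in>{c. c dvd b} \<times> {d. d dvd a}. F (d * c))"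
    by (subst prod.reindex_bij_betw[symmetric]) (auto simp: case_prod_unfold)
  then show ?thesis by (simp add: prod.cartesian_product)
qed

text \<open>For \<open>j\<close> dividing \<open>n\<close>, the product of the right-hand sides over the divisors of \<open>j\<close> runs through all
  divisors of \<open>a * j\<close>, so it is the period polynomial of \<open>f\<close> at \<open>a * j\<close>, which is that of the iterate at \<open>j\<close>.\<close>

lemma dynatomic_poly_iter_coprime:
  fixes f :: "'a :: idom poly"
  assumes monic: "lead_coeff f = 1" and deg: "degree f \<noteq> 1"
    and pos: "a > 0" "n > 0" and "coprime a n"
  shows "dynatomic (poly_iter f a) n = (\<Prod>d | d dvd a. dynatomic f (d * n))"
proof (rule dynatomic_eqI)
  fix j assume "j dvd n"
  then have j: "j > 0" using pos by (auto intro: Nat.gr0I)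
  have "coprime a j" by (rule coprime_divisors[OF dvd_refl \<open>j dvd n\<close> \<open>coprime a n\<close>])
  then have "(\<Prod>c | c dvd j. \<Prod>d | d dvd a. dynatomic f (d * c)) = period_poly f (a * j)"
    using pos j by (simp add: prod_divisors_coprime_mult[symmetric] prod_dynatomic[OF monic deg])
  then show "(\<Prod>c | c dvd j. \<Prod>d | d dvd a. dynatomic f (d * c)) = period_poly (poly_iter f a) j"
    by (simp add: poly_iter_mult)
  show "period_poly (poly_iter f a) j \<noteq> 0"
    using period_poly_nonzero[OF monic deg, of "a * j"] pos j by (simp add: poly_iter_mult)
qed (use pos in simp)

section \<open>Cyclotomic polynomials\<close>

lemma prod_roots_of_unity:
  assumes "n > 0"
  shows "(\<Prod>j\<in>{1..n}. [:- cis (2 * pi * real j / real n), 1:]) = monom 1 n - 1"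
proof -
  let ?p = "monom 1 n - 1 :: complex poly"
  have deg: "degree ?p = n" and lc: "lead_coeff ?p = 1"
  proof -
    have "?p = - 1 + monom 1 n" by simp
    then show "degree ?p = n" "lead_coeff ?p = 1"
      using assms degree_add_eq_right[of "- 1" "monom 1 n :: complex poly"]
        lead_coeff_add_le[of "- 1" "monom 1 n :: complex poly"] by (simp_all add: degree_monom_eq)
  qed
  have roots: "{z. poly ?p z = 0} = {z. z ^ n = 1}" by (auto simp: poly_monom)
  have "rsquarefree ?p"
    unfolding rsquarefree_roots
    using assms by (auto simp: pderiv_diff pderiv_monom poly_monom pderiv_1 power_0_left)
  then have roots_prod: "(\<Prod>z | z ^ n = 1. [:- z, 1:]) = ?p"
    using complex_poly_decompose_rsquarefree[of ?p] by (simp only: lc roots smult_1_left)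
  have "bij_betw (\<lambda>k. cis (2 * pi * real k / real n)) {1..n} {z. z ^ n = 1}"
  proof -
    have "bij_betw (\<lambda>j. j mod n) {1..n} {..<n}"
    proof (rule bij_betw_byWitness[where f' = "\<lambda>j. if j = 0 then n else j"])
      show "\<forall>a\<in>{1..n}. (if a mod n = 0 then n else a mod n) = a"
        using assms by (auto simp: le_less nat_dvd_not_less)
    qed (use assms in \<open>auto intro: less_imp_le\<close>)
    then have "bij_betw ((\<lambda>k. cis (2 * pi * real k / real n)) \<circ> (\<lambda>j. j mod n)) {1..n} {z. z ^ n = 1}"
      by (rule bij_betw_trans[OF _ bij_betw_roots_unity[OF assms]])
    moreover have "cis (2 * pi * real (j mod n) / real n) = cis (2 * pi * real j / real n)" if "j \<in> {1..n}" for j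
      using that by (cases "j = n") (auto simp: le_less)
    ultimately show ?thesis
      by (subst bij_betw_cong[of _ _ "(\<lambda>k. cis (2 * pi * real k / real n)) \<circ> (\<lambda>j. j mod n)"]) auto
  qed
  from prod.reindex_bij_betw[OF this, of "\<lambda>z. [:- z, 1:]"] show ?thesis
    unfolding roots_prod .
qed

text \<open>Every fraction \<open>i / n\<close> with \<open>i\<close> in \<open>{1..n}\<close> has a unique reduced form \<open>j / d\<close>, so the primitive roots of unity
  of the orders dividing \<open>n\<close> are the \<open>n\<close>-th roots of unity.\<close>

lemma prod_complex_cyclotomic:
  assumes n: "n > 0"
  shows "(\<Prod>d | d dvd n. \<Prod>j | j \<in> {1..d} \<and> coprime j d. [:- cis (2 * pi * real j / real d), 1:])
    = monom 1 n - 1"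
proof -
  let ?S = "SIGMA d:{d. d dvd n}. {j. j \<in> {1..d} \<and> coprime j d}"
  have "bij_betw (\<lambda>(d, j). j * (n div d)) ?S {1..n}"
  proof (rule bij_betw_byWitness[where f' = "\<lambda>i. (n div gcd i n, i div gcd i n)"])
    show "\<forall>x\<in>?S. (\<lambda>i. (n div gcd i n, i div gcd i n)) ((\<lambda>(d, j). j * (n div d)) x) = x"
    proof
      fix x assume "x \<in> ?S"
      then obtain d j where x: "x = (d, j)" "d dvd n" "coprime j d" by auto
      then obtain c where c: "n = d * c" by auto
      have pos: "d > 0" "c > 0" using n c by auto
      have "gcd (j * c) (d * c) = c"
        using x by (simp add: gcd_mult_right coprime_iff_gcd_eq_1 gcd.commute)
      then show "(\<lambda>i. (n div gcd i n, i div gcd i n)) ((\<lambda>(d, j). j * (n div d)) x) = x"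
        using pos c x by simp
    qed
    show "\<forall>i\<in>{1..n}. (\<lambda>(d, j). j * (n div d)) (n div gcd i n, i div gcd i n) = i"
    proof
      fix i assume "i \<in> {1..n}"
      obtain c where c: "n = gcd i n * c" by (meson gcd_dvd2 dvdE)
      then have "c > 0" using n by (auto intro: Nat.gr0I)
      moreover have "gcd i n > 0" using n by simp
      ultimately have "n div (n div gcd i n) = gcd i n"
        using c by (metis nonzero_mult_div_cancel_left nonzero_mult_div_cancel_right neq0_conv)
      then show "(\<lambda>(d, j). j * (n div d)) (n div gcd i n, i div gcd i n) = i" by simp
    qed
    show "(\<lambda>(d, j). j * (n div d)) ` ?S \<subseteq> {1..n}"
    proof clarify
      fix d j assume d: "d dvd n" and j: "j \<in> {1..d}" "coprime j d"
      then obtain c where c: "n = d * c" by auto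
      have pos: "d > 0" "c > 0" using n c by auto
      then show "j * (n div d) \<in> {1..n}" using j c by auto
    qed
    have "n div gcd i n dvd n" for i by (metis dvd_div_mult_self dvd_triv_left gcd_dvd2)
    then show "(\<lambda>i. (n div gcd i n, i div gcd i n)) ` {1..n} \<subseteq> ?S"
      using n by (auto intro!: div_le_mono div_gcd_coprime simp: Suc_le_eq div_greater_zero_iff dvd_imp_le gcd_le1_nat)
  qed
  then have "(\<Prod>j\<in>{1..n}. [:- cis (2 * pi * real j / real n), 1:])
      = (\<Prod>(d, j)\<in>?S. [:- cis (2 * pi * real (j * (n div d)) / real n), 1:])"
    by (subst prod.reindex_bij_betw[symmetric]) (auto simp: case_prod_unfold)
  also have "\<dots> = (\<Prod>(d, j)\<in>?S. [:- cis (2 * pi * real j / real d), 1:])"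
    using n by (intro prod.cong refl) (auto elim!: dvdE simp: mult.assoc)
  also have "\<dots> = (\<Prod>d | d dvd n. \<Prod>j | j \<in> {1..d} \<and> coprime j d. [:- cis (2 * pi * real j / real d), 1:])"
    using n by (subst prod.Sigma) auto
  finally show ?thesis unfolding prod_roots_of_unity[OF n] by (rule sym)
qed

text \<open>The products over primitive roots of unity are monic complex polynomials, and multiply up to
  \<open>x\<^sup>n - 1\<close>; by descent they have integer coefficients, so \<open>cyclotomic\<close> denotes them.\<close>

lemma prod_cyclotomic:
  assumes n: "n > 0"
  shows "(\<Prod>d | d dvd n. cyclotomic d) = monom 1 n - 1"
proof -
  define v :: "nat \<Rightarrow> complex poly"
    where "v d = (\<Prod>j | j \<in> {1..d} \<and> coprime j d. [:- cis (2 * pi * real j / real d), 1:])" for d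
  have monic: "lead_coeff (v d) = 1" for d unfolding v_def lead_coeff_prod by simp
  have hom: "inj_idom_hom (of_int :: int \<Rightarrow> complex)" ..
  obtain w :: "nat \<Rightarrow> int poly" where w: "\<And>n. n > 0 \<Longrightarrow> map_poly of_int (w n) = v n"
    "\<And>n. n > 0 \<Longrightarrow> (\<Prod>d | d dvd n. w d) = monom 1 n - 1"
  proof (rule divisor_factors_descend[OF hom, of v "\<lambda>n. monom 1 n - 1"])
    show "(\<Prod>d | d dvd n. v d) = map_poly of_int (monom 1 n - 1)" if "n > 0" for n
      unfolding v_def prod_complex_cyclotomic[OF that] by (simp add: hom_distribs)
  qed (use monic in auto)
  have "cyclotomic d = w d" if "d > 0" for d
    unfolding cyclotomic_def v_def[symmetric]
    by (rule the_equality) (simp_all flip: w(1)[OF that])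
  then have "(\<Prod>d | d dvd n. cyclotomic d) = (\<Prod>d | d dvd n. w d)"
    using n by (intro prod.cong) (auto intro: Nat.gr0I)
  then show ?thesis using w(2)[OF n] by simp
qed

lemma prod_cyclotomic_eval:
  assumes "n > 0"
  shows "(\<Prod>d | d dvd n. cyclotomic_eval d x) = x ^ n - 1"
proof -
  have "(\<Prod>d | d dvd n. cyclotomic_eval d x) = poly (map_poly of_int (\<Prod>d | d dvd n. cyclotomic d)) x"
    by (simp add: cyclotomic_eval_def poly_prod of_int_poly_hom.hom_prod)
  then show ?thesis
    by (simp add: prod_cyclotomic[OF assms] hom_distribs poly_monom)
qed

lemma cyclotomic_eval_hom:
  assumes "comm_ring_hom h"
  shows "h (cyclotomic_eval n x) = cyclotomic_eval n (h x)"
proof -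
  interpret comm_ring_hom h by fact
  have "map_poly of_int (cyclotomic n) = map_poly h (map_poly of_int (cyclotomic n))"
    by (simp add: map_poly_map_poly o_def hom_of_int)
  then show ?thesis by (simp add: cyclotomic_eval_def)
qed

section \<open>Dynatomic values at a fixed point\<close>

text \<open>At a fixed point \<open>b\<close> each period polynomial is \<open>z - b\<close> times some \<open>H j\<close>, and \<open>H j\<close> takes at \<open>b\<close> the value of
  the derivative, \<open>x ^ j - 1\<close>. The factor \<open>z - b\<close> belongs to the dynatomic polynomial of index 1,
  so the values of the others, with \<open>x - 1\<close> put in at index 1, satisfy the divisor product
  equations of the cyclotomic values. The hypothesis \<open>generic\<close> makes the solution unique.\<close>

lemma dynatomic_at_fixed_point_generic:
  fixes g :: "'a :: idom poly"
  assumes monic: "lead_coeff g = 1" and deg: "degree g \<noteq> 1"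
    and fixed: "poly g b = b"
    and generic: "\<And>j. j > 0 \<Longrightarrow> poly (pderiv g) b ^ j \<noteq> 1"
    and n: "n > 1"
  shows "poly (dynatomic g n) b = cyclotomic_eval n (poly (pderiv g) b)"
proof -
  define x where "x = poly (pderiv g) b"
  have "\<exists>H. period_poly g j = [:- b, 1:] * H" for j
  proof -
    have "(poly g ^^ j) b = b" using fixed by (induction j) auto
    then have "poly (period_poly g j) b = 0" by (simp add: poly_poly_iter)
    then have "[:- b, 1:] dvd period_poly g j" by (rule poly_eq_0_iff_dvd[THEN iffD1])
    then show ?thesis by (elim dvdE) blast
  qed
  then obtain H where H: "\<And>j. period_poly g j = [:- b, 1:] * H j" by metis
  have H_b: "poly (H j) b = x ^ j - 1" for j
  proof -
    have "poly (pderiv (period_poly g j)) b = x ^ j - 1"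
      by (simp add: pderiv_diff pderiv_pCons pderiv_poly_iter_at_fixed_point[OF fixed] x_def)
    moreover have "poly (pderiv ([:- b, 1:] * H j)) b = poly (H j) b"
      by (simp only: pderiv_mult) (simp add: pderiv_pCons)
    ultimately show ?thesis using H by simp
  qed
  have dyn_1: "dynatomic g 1 = [:- b, 1:] * H 1"
    using prod_dynatomic[OF monic deg, of 1] H[of 1] by simp
  define p where "p d = (if d = 1 then x - 1 else poly (dynatomic g d) b)" for d
  have p_prod: "(\<Prod>d | d dvd j. p d) = x ^ j - 1" if j: "j > 0" for j
  proof -
    have split: "(\<Prod>d | d dvd j. v d) = v 1 * (\<Prod>d | d dvd j \<and> d \<noteq> 1. v d)"
      for v :: "nat \<Rightarrow> 'c :: comm_monoid_mult"
    proof -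
      have "{d. d dvd j} = insert 1 {d. d dvd j \<and> d \<noteq> 1}" by auto
      moreover have "finite {d. d dvd j \<and> d \<noteq> 1}" using j by simp
      ultimately show ?thesis by simp
    qed
    have "[:- b, 1:] * (H 1 * (\<Prod>d | d dvd j \<and> d \<noteq> 1. dynatomic g d)) = [:- b, 1:] * H j"
      using prod_dynatomic[OF monic deg j] unfolding split H dyn_1 by (simp only: mult.assoc)
    then have "H 1 * (\<Prod>d | d dvd j \<and> d \<noteq> 1. dynatomic g d) = H j"
      by (subst (asm) mult_cancel_left) simp
    then have "(x - 1) * (\<Prod>d | d dvd j \<and> d \<noteq> 1. poly (dynatomic g d) b) = x ^ j - 1"
      using H_b[of 1] H_b[of j] by (metis poly_mult poly_prod power_one_right)
    then show ?thesis by (simp add: split p_def)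
  qed
  have "p n = cyclotomic_eval n x"
  proof (rule divisor_product_unique)
    fix j assume "j dvd n"
    then have j: "j > 0" using n by (auto intro: Nat.gr0I)
    show "(\<Prod>d | d dvd j. p d) = (\<Prod>d | d dvd j. cyclotomic_eval d x)"
      using j by (simp add: p_prod prod_cyclotomic_eval)
    show "(\<Prod>d | d dvd j. cyclotomic_eval d x) \<noteq> 0"
      using j generic[OF j] by (simp add: prod_cyclotomic_eval x_def)
  qed (use n in simp)
  then show ?thesis using n by (simp add: p_def x_def)
qed

text \<open>Adding \<open>t (z - b)\<close> with a new variable \<open>t\<close> keeps \<open>b\<close> fixed and raises the derivative there by \<open>t\<close>,
  so that no positive power of it is 1. The generic formula then holds over the polynomial ring in \<open>t\<close>, and
  setting \<open>t = 0\<close> gives the claim. In degree 0 this perturbation would produce the excluded degree 1, but there the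
  derivative is 0 and the generic formula applies directly.\<close>

lemma dynatomic_at_fixed_point:
  fixes g :: "'a :: idom poly"
  assumes monic: "lead_coeff g = 1" and deg: "degree g \<noteq> 1"
    and fixed: "poly g b = b" and n: "n > 1"
  shows "poly (dynatomic g n) b = cyclotomic_eval n (poly (pderiv g) b)"
proof (cases "degree g = 0")
  case True
  then show ?thesis
    using monic_degree_0[OF monic True] fixed n monic deg
    by (intro dynatomic_at_fixed_point_generic) (auto simp: pderiv_pCons power_0_left)
next
  case False
  interpret L: map_poly_inj_idom_hom "\<lambda>c :: 'a. [:c:]" ..
  define t :: "'a poly" where "t = [:0, 1:]"
  define \<mu> where "\<mu> = poly (pderiv g) b"
  define G where "G = map_poly (\<lambda>c. [:c:]) g + [:- (t * [:b:]), t:]"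
  have "degree [:- (t * [:b:]), t:] < degree (map_poly (\<lambda>c. [:c:]) g)"
    using False deg by (simp add: t_def)
  then have G: "degree G = degree g" "lead_coeff G = 1"
    using monic lead_coeff_add_le[of "[:- (t * [:b:]), t:]" "map_poly (\<lambda>c. [:c:]) g"]
    by (simp_all add: G_def degree_add_eq_left add.commute)
  have G_fixed: "poly G [:b:] = [:b:]"
    using fixed by (simp add: G_def coeff_lift_hom.poly_map_poly)
  have "pderiv G = map_poly (\<lambda>c. [:c:]) (pderiv g) + [:t:]"
    by (simp add: G_def pderiv_add pderiv_pCons coeff_lift_hom.map_poly_pderiv)
  then have G_mult: "poly (pderiv G) [:b:] = [:\<mu>, 1:]"
    by (simp add: \<mu>_def t_def coeff_lift_hom.poly_map_poly)
  have "[:\<mu>, 1:] ^ j \<noteq> 1" if "j > 0" for j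
  proof -
    have "degree ([:\<mu>, 1:] ^ j) = j" by (simp add: degree_power_eq)
    then show ?thesis using that by (metis degree_1 neq0_conv)
  qed
  then have "poly (dynatomic G n) [:b:] = cyclotomic_eval n [:\<mu>, 1:]"
    using dynatomic_at_fixed_point_generic[OF G(2) _ G_fixed _ n] G(1) deg by (simp add: G_mult)
  then have eq: "poly (poly (dynatomic G n) [:b:]) 0 = poly (cyclotomic_eval n [:\<mu>, 1:]) 0" by simp
  let ?ev = "\<lambda>c :: 'a poly. poly c 0"
  have ev: "comm_ring_hom ?ev" ..
  have "map_poly ?ev (map_poly (\<lambda>c. [:c:]) g) = g"
    by (simp add: map_poly_map_poly o_def)
  then have "map_poly ?ev G = g"
    by (simp add: G_def t_def poly_hom.map_poly_hom_add poly_hom.map_poly_pCons_hom)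
  then have "map_poly ?ev (dynatomic G n) = dynatomic g n"
    using map_dynatomic[OF ev G(2)] G(1) deg n by simp
  then have "poly (poly (dynatomic G n) [:b:]) 0 = poly (dynatomic g n) b"
    using poly_hom.poly_map_poly[of 0 "dynatomic G n" "[:b:]"] by simp
  moreover have "poly (cyclotomic_eval n [:\<mu>, 1:]) 0 = cyclotomic_eval n \<mu>"
    using cyclotomic_eval_hom[OF ev, of n "[:\<mu>, 1:]"] by simp
  ultimately show ?thesis using eq by (simp add: \<mu>_def)
qed

section \<open>The multiplier formula\<close>

text \<open>Each prime of \<open>k\<close> occurs in the \<open>k\<close>-part of \<open>m\<close> with its full multiplicity in \<open>m\<close>. This makes a
  point of period \<open>k\<close> a fixed point of the iterate of that order.\<close>

lemma dvd_part_of: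
  assumes "k > 0" "m > 0" "k dvd m"
  shows "k dvd part_of k m"
proof -
  have "k = (\<Prod>p\<in>prime_factors k. p ^ multiplicity p k)" using assms by (simp add: prod_prime_factors)
  also have "\<dots> dvd part_of k m"
    unfolding part_of_def using assms
    by (intro prod_dvd_prod le_imp_power_dvd dvd_imp_multiplicity_le) auto
  finally show ?thesis .
qed

lemma coprime_part_of_part_prime_to: "coprime (part_of k m) (part_prime_to k m)"
  unfolding part_of_def part_prime_to_def
proof (intro prod_coprime_left prod_coprime_right)
  fix p q assume "p \<in> prime_factors k" "q \<in> {p. p \<in> prime_factors m \<and> \<not> p dvd k}"
  then have "prime p" "prime q" "p \<noteq> q" by auto
  then show "coprime (p ^ multiplicity p m) (q ^ multiplicity q m)"
    by (simp add: primes_coprime)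
qed

theorem proposition1p15:
  fixes f :: "'a :: idom poly"
    and k m mt m' :: nat
    and \<alpha> lam :: "'a fract alg_closure"
  assumes monic: "lead_coeff f = 1"
    and deg: "degree f \<noteq> 1"  \<comment> \<open>otherwise the dynatomic quotients below are 0/0, i.e. undefined\<close>
    and "k > 0" and "m > 0" and "k dvd m"
    and "\<exists>p. prime p \<and> p dvd m \<and> \<not> p dvd k"
    and per: "has_exact_period (poly (base_change f)) \<alpha> k"
    and lam: "lam = multiplier f k \<alpha>"
    and mt: "mt = part_of k m"
    and m': "m' = part_prime_to k m"
  shows "(\<Prod>d | d dvd mt. poly (base_change (dynatomic f (d * m'))) \<alpha>)
           = poly (base_change (dynatomic (poly_iter f mt) m')) \<alpha>
         \<and> poly (base_change (dynatomic (poly_iter f mt) m')) \<alpha>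
           = cyclotomic_eval m' (lam ^ (mt div k))"
proof -
  interpret H: inj_idom_hom "emb :: 'a \<Rightarrow> _" by (rule emb_hom)
  interpret P: map_poly_inj_idom_hom "emb :: 'a \<Rightarrow> _" ..
  have hom: "comm_ring_hom (emb :: 'a \<Rightarrow> _)" ..
  have m'_gt: "m' > 1"
    using assms(6) \<open>m > 0\<close> unfolding m' by (elim exE conjE) (rule part_prime_to_gt_1)
  have k_dvd: "k dvd mt" unfolding mt using \<open>k > 0\<close> \<open>m > 0\<close> \<open>k dvd m\<close> by (rule dvd_part_of)
  have "mt * m' = m"
    unfolding mt m' using \<open>k > 0\<close> \<open>m > 0\<close> \<open>k dvd m\<close> by (rule part_of_times_part_prime_to)
  then have mt_pos: "mt > 0" using \<open>m > 0\<close> by (auto intro: Nat.gr0I)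
  have cop: "coprime mt m'" unfolding mt m' by (rule coprime_part_of_part_prime_to)
  have first: "(\<Prod>d | d dvd mt. poly (base_change (dynatomic f (d * m'))) \<alpha>)
      = poly (base_change (dynatomic (poly_iter f mt) m')) \<alpha>"
    using dynatomic_poly_iter_coprime[OF monic deg mt_pos _ cop] m'_gt
    by (simp add: P.hom_prod poly_prod)

  define F where "F = base_change f"
  define g where "g = poly_iter F mt"
  have g: "base_change (poly_iter f mt) = g" by (simp add: g_def F_def map_poly_iter[OF hom])
  have iter_deg: "degree (poly_iter f mt) \<noteq> 1"
    using deg mt_pos by (simp add: degree_poly_iter)
  have iter_monic: "lead_coeff (poly_iter f mt) = 1" using monic by (rule monic_poly_iter)
  have g_iter: "g = poly_iter (poly_iter F k) (mt div k)"
    using k_dvd by (simp add: g_def poly_iter_mult[symmetric])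
  have fixed_k: "poly (poly_iter F k) \<alpha> = \<alpha>"
    using per by (simp add: has_exact_period_def poly_poly_iter F_def)
  then have "(poly (poly_iter F k) ^^ j) \<alpha> = \<alpha>" for j by (induction j) auto
  then have fixed: "poly g \<alpha> = \<alpha>" by (simp add: g_iter poly_poly_iter[of "poly_iter F k"])
  have "lam = poly (pderiv (poly_iter F k)) \<alpha>"
    by (simp add: lam multiplier_def F_def map_poly_iter[OF hom])
  then have mult: "poly (pderiv g) \<alpha> = lam ^ (mt div k)"
    using pderiv_poly_iter_at_fixed_point[OF fixed_k] by (simp add: g_iter)
  have "poly (base_change (dynatomic (poly_iter f mt) m')) \<alpha> = poly (dynatomic g m') \<alpha>"
    using map_dynatomic[OF hom iter_monic iter_deg] m'_gt by (simp add: g)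
  also have "\<dots> = cyclotomic_eval m' (poly (pderiv g) \<alpha>)"
  proof (rule dynatomic_at_fixed_point[OF _ _ fixed m'_gt])
    show "lead_coeff g = 1" "degree g \<noteq> 1" unfolding g[symmetric]
      using iter_monic iter_deg by simp_all
  qed
  finally show ?thesis using first by (simp add: mult)
qed

end
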